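(* Consider the decision-dependent distributionally robust problem $$\min_{x\in\mathcal X}\; c^\top x+x^\top C x+\max_{p\in\mathcal P(x)}\ \sum_{\omega=1}^N p_\omega\, h(x,\xi_\omega).\qquad (\mathrm{DRO})$$ Then (DRO) can be reformulated as the two-stage stochastic mixed-integer nonlinear program $$\min_{x,\lambda}\Big\{c^\top x+x^\top C x+\lambda^\top\vartheta(x)+\sum_{\omega\in[N]}G_\omega(x,\lambda)\;:\;x\in\mathcal X,\ \lambda\in\mathbb R^s,\ \lambda\ge 0\Big\},$$ where, for $\omega\in[N]$, $$G_\omega(x,\lambda)=\min_{y,\mu,\gamma}\Big\{\gamma\,\overline p_\omega-\mu\,\underline p_\omega\;:\;\gamma-\mu\ge\psi_0(x,y,\xi_\omega)-\lambda^\top g(\xi_\omega),\ y\in\mathcal Y(x,\xi_\omega),\ \gamma\ge 0,\ \mu\ge 0\Big\}.$$ That is, the two problems have the same optimal value, and $x^*\in\mathcal X$ is optimal for (DRO) if and only if there is $\lambda^*\ge 0$ such that $(x^*,\lambda^* )$ is optimal for the second problem.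
   Context: Notation: $[n]=\{1,\dots,n\}$; vector inequalities are componentwise. Setting. $\mathcal X=\{x\in\mathbb Z^{n_1}\times\mathbb R^{n_x-n_1}: Ax\ge d,\ x\ge 0\}$ is nonempty and compact, $n_1\ge 0$. The random vector $\xi$ has finite, decision-independent support $\{\xi_\omega\}_{\omega=1}^N$. The recourse function is $$h(x,\xi_\omega)=\min_{y\in\mathcal Y(x,\xi_\omega)}\psi_0(x,y,\xi_\omega),\qquad \psi_0(x,y,\xi_\omega)=q_\omega^\top y+x^\top L_\omega y,$$ $$\mathcal Y(x,\xi_\omega)=\{y\in\mathbb R^{n_y}: D_\omega y\ge B_\omega x+b_\omega,\ y\ge 0\},$$ with data $q_\omega,L_\omega,D_\omega,B_\omega,b_\omega$ of appropriate dimensions. Ambiguity set. For $x\in\mathcal X$, $$\mathcal P(x)=\Big\{p\in\mathbb R^N,\ p\ge 0:\ \underline p_\omega\le p_\omega\le\overline p_\omega\ (\omega\in[N]),\ \sum_{\omega\in[N]}p_\omega g^i(\xi_\omega)\le\vartheta^i(x)\ (i\in[s])\Big\},$$ where $0\le\underline p_\omega\le\overline p_\omega$ are bounds on the probabilities, $g^i$ are real functions on the support, $\vartheta^i:\mathcal X\to\mathbb R$, and $g=(g^1,\dots,g^s)^\top$, $\vartheta(x)=(\vartheta^1(x),\dots,\vartheta^s(x))^\top$. To force $p$ to be a probability vector, $g^1\equiv 1,\vartheta^1\equiv 1,g^2\equiv -1,\vartheta^2\equiv -1$. Standing assumptions. $\mathcal P(x)$ is nonempty for every $x\in\mathcal X$.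 For every $x\in\mathbb R^{n_x}$ and $\omega\in[N]$ the recourse problem has complete recourse (it is feasible, $\mathcal Y(x,\xi_\omega)\neq\emptyset$) and $\mathcal Y(x,\xi_\omega)$ is bounded. *)

theory Defs
  imports "HOL-Analysis.Analysis"
begin

(* Finite index types: 'n variables x, 'm recourse variables y, 'r first-stage rows,
   'l recourse rows, 'w scenarios, 's ambiguity constraints, 'k components of the random vector.
   The order on vectors is the componentwise one. *)

(* I is the set of integer-constrained coordinates; it may be empty. *)
definition first_stage :: "'n set \<Rightarrow> real^'n^'r \<Rightarrow> real^'r \<Rightarrow> (real^'n) set" where
  "first_stage I A d = {x. (\<forall>j\<in>I. x $ j \<in> \<int>) \<and> A *v x \<ge> d \<and> x \<ge> 0}"

definition psi0 ::
  "('w \<Rightarrow> real^'m) \<Rightarrow> ('w \<Rightarrow> real^'m^'n) \<Rightarrow> real^'n \<Rightarrow> real^'m \<Rightarrow> 'w \<Rightarrow> real" where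
  "psi0 q L x y \<omega> = q \<omega> \<bullet> y + x \<bullet> (L \<omega> *v y)"

definition recourse_set ::
  "('w \<Rightarrow> real^'m^'l) \<Rightarrow> ('w \<Rightarrow> real^'n^'l) \<Rightarrow> ('w \<Rightarrow> real^'l) \<Rightarrow> real^'n \<Rightarrow> 'w \<Rightarrow> (real^'m) set" where
  "recourse_set D B b x \<omega> = {y. D \<omega> *v y \<ge> B \<omega> *v x + b \<omega> \<and> y \<ge> 0}"

(* The inner minima and maximum are written as Inf and Sup in the reals; the lemmas
   recourse_min_attained, worst_case_attained and G_min_attained below show that they are
   attained whenever the recourse sets are nonempty and bounded and the ambiguity set is nonempty. *)
definition recourse ::
  "('w \<Rightarrow> real^'m) \<Rightarrow> ('w \<Rightarrow> real^'m^'n) \<Rightarrow> ('w \<Rightarrow> real^'m^'l) \<Rightarrow> ('w \<Rightarrow> real^'n^'l) \<Rightarrow>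
   ('w \<Rightarrow> real^'l) \<Rightarrow> real^'n \<Rightarrow> 'w \<Rightarrow> real" where
  "recourse q L D B b x \<omega> = (INF y \<in> recourse_set D B b x \<omega>. psi0 q L x y \<omega>)"

definition ambiguity_set ::
  "real^'w \<Rightarrow> real^'w \<Rightarrow> ('w \<Rightarrow> real^'k) \<Rightarrow> (real^'k \<Rightarrow> real^'s) \<Rightarrow> (real^'n \<Rightarrow> real^'s) \<Rightarrow>
   real^'n \<Rightarrow> (real^'w) set" where
  "ambiguity_set pl pu \<xi> g \<theta> x =
     {p. p \<ge> 0 \<and> (\<forall>\<omega>. pl $ \<omega> \<le> p $ \<omega> \<and> p $ \<omega> \<le> pu $ \<omega>) \<and>
         (\<forall>i. (\<Sum>\<omega>\<in>UNIV. p $ \<omega> * g (\<xi> \<omega>) $ i) \<le> \<theta> x $ i)}"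

definition dro_objective ::
  "real^'n \<Rightarrow> real^'n^'n \<Rightarrow> ('w \<Rightarrow> real^'m) \<Rightarrow> ('w \<Rightarrow> real^'m^'n) \<Rightarrow> ('w \<Rightarrow> real^'m^'l) \<Rightarrow>
   ('w \<Rightarrow> real^'n^'l) \<Rightarrow> ('w \<Rightarrow> real^'l) \<Rightarrow> real^'w \<Rightarrow> real^'w \<Rightarrow> ('w \<Rightarrow> real^'k) \<Rightarrow>
   (real^'k \<Rightarrow> real^'s) \<Rightarrow> (real^'n \<Rightarrow> real^'s) \<Rightarrow> real^'n \<Rightarrow> real" where
  "dro_objective c C q L D B b pl pu \<xi> g \<theta> x =
     c \<bullet> x + x \<bullet> (C *v x) +
     (SUP p \<in> ambiguity_set pl pu \<xi> g \<theta> x. \<Sum>\<omega>\<in>UNIV. p $ \<omega> * recourse q L D B b x \<omega>)"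

definition G_feasible ::
  "('w \<Rightarrow> real^'m) \<Rightarrow> ('w \<Rightarrow> real^'m^'n) \<Rightarrow> ('w \<Rightarrow> real^'m^'l) \<Rightarrow> ('w \<Rightarrow> real^'n^'l) \<Rightarrow>
   ('w \<Rightarrow> real^'l) \<Rightarrow> ('w \<Rightarrow> real^'k) \<Rightarrow> (real^'k \<Rightarrow> real^'s) \<Rightarrow>
   'w \<Rightarrow> real^'n \<Rightarrow> real^'s \<Rightarrow> ((real^'m) \<times> real \<times> real) set" where
  "G_feasible q L D B b \<xi> g \<omega> x l =
     {(y, \<mu>, \<gamma>). \<gamma> - \<mu> \<ge> psi0 q L x y \<omega> - l \<bullet> g (\<xi> \<omega>) \<and>
                y \<in> recourse_set D B b x \<omega> \<and> \<gamma> \<ge> 0 \<and> \<mu> \<ge> 0}"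

definition G ::
  "('w \<Rightarrow> real^'m) \<Rightarrow> ('w \<Rightarrow> real^'m^'n) \<Rightarrow> ('w \<Rightarrow> real^'m^'l) \<Rightarrow> ('w \<Rightarrow> real^'n^'l) \<Rightarrow>
   ('w \<Rightarrow> real^'l) \<Rightarrow> real^'w \<Rightarrow> real^'w \<Rightarrow> ('w \<Rightarrow> real^'k) \<Rightarrow> (real^'k \<Rightarrow> real^'s) \<Rightarrow>
   'w \<Rightarrow> real^'n \<Rightarrow> real^'s \<Rightarrow> real" where
  "G q L D B b pl pu \<xi> g \<omega> x l =
     (INF (y, \<mu>, \<gamma>) \<in> G_feasible q L D B b \<xi> g \<omega> x l. \<gamma> * pu $ \<omega> - \<mu> * pl $ \<omega>)"

definition two_stage_objective ::
  "real^'n \<Rightarrow> real^'n^'n \<Rightarrow> ('w \<Rightarrow> real^'m) \<Rightarrow> ('w \<Rightarrow> real^'m^'n) \<Rightarrow> ('w \<Rightarrow> real^'m^'l) \<Rightarrow>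
   ('w \<Rightarrow> real^'n^'l) \<Rightarrow> ('w \<Rightarrow> real^'l) \<Rightarrow> real^'w \<Rightarrow> real^'w \<Rightarrow> ('w \<Rightarrow> real^'k) \<Rightarrow>
   (real^'k \<Rightarrow> real^'s) \<Rightarrow> (real^'n \<Rightarrow> real^'s) \<Rightarrow> real^'n \<Rightarrow> real^'s \<Rightarrow> real" where
  "two_stage_objective c C q L D B b pl pu \<xi> g \<theta> x l =
     c \<bullet> x + x \<bullet> (C *v x) + l \<bullet> \<theta> x + (\<Sum>\<omega>\<in>UNIV. G q L D B b pl pu \<xi> g \<omega> x l)"

lemma compact_recourse_set:
  assumes "bounded (recourse_set D B b x \<omega>)"
  shows "compact (recourse_set D B b x \<omega>)"
proof -
  have "closed (recourse_set D B b x \<omega>)"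
    unfolding recourse_set_def less_eq_vec_def
    by (intro closed_Collect_conj closed_Collect_all closed_Collect_le continuous_intros
        matrix_vector_mult_linear_continuous_on)
  with assms show ?thesis
    by (simp add: compact_eq_bounded_closed)
qed

lemma continuous_on_psi0: "continuous_on S (\<lambda>y. psi0 q L x y \<omega>)"
  unfolding psi0_def
  by (intro continuous_intros matrix_vector_mult_linear_continuous_on)

lemma recourse_min_attained:
  assumes "recourse_set D B b x \<omega> \<noteq> {}" and "bounded (recourse_set D B b x \<omega>)"
  shows "\<exists>y\<in>recourse_set D B b x \<omega>. recourse q L D B b x \<omega> = psi0 q L x y \<omega> \<and>
           (\<forall>z\<in>recourse_set D B b x \<omega>. psi0 q L x y \<omega> \<le> psi0 q L x z \<omega>)"
proof -
  obtain y where y: "y \<in> recourse_set D B b x \<omega>"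
    "\<forall>z\<in>recourse_set D B b x \<omega>. psi0 q L x y \<omega> \<le> psi0 q L x z \<omega>"
    using continuous_attains_inf[OF compact_recourse_set[OF assms(2)] assms(1) continuous_on_psi0[where q=q and L=L and x=x and \<omega>=\<omega>]]
    by blast
  then have "recourse q L D B b x \<omega> = psi0 q L x y \<omega>"
    unfolding recourse_def by (intro cInf_eq_minimum) auto
  with y show ?thesis by blast
qed

lemma worst_case_attained:
  assumes "ambiguity_set pl pu \<xi> g \<theta> x \<noteq> {}"
  shows "\<exists>p\<in>ambiguity_set pl pu \<xi> g \<theta> x.
           (SUP p \<in> ambiguity_set pl pu \<xi> g \<theta> x. \<Sum>\<omega>\<in>UNIV. p $ \<omega> * h \<omega>) = (\<Sum>\<omega>\<in>UNIV. p $ \<omega> * h \<omega>) \<and>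
           (\<forall>p'\<in>ambiguity_set pl pu \<xi> g \<theta> x. (\<Sum>\<omega>\<in>UNIV. p' $ \<omega> * h \<omega>) \<le> (\<Sum>\<omega>\<in>UNIV. p $ \<omega> * h \<omega>))"
    (is "\<exists>p\<in>?P. _")
proof -
  have "closed ?P"
    unfolding ambiguity_set_def less_eq_vec_def
    by (intro closed_Collect_conj closed_Collect_all closed_Collect_le continuous_intros)
  moreover have "?P \<subseteq> cbox pl pu"
    by (auto simp: ambiguity_set_def mem_box_cart)
  ultimately have "compact ?P"
    using bounded_cbox bounded_subset compact_eq_bounded_closed by blast
  moreover have "continuous_on ?P (\<lambda>p. \<Sum>\<omega>\<in>UNIV. p $ \<omega> * h \<omega>)"
    by (intro continuous_intros)
  ultimately obtain p where p: "p \<in> ?P"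
    "\<forall>p'\<in>?P. (\<Sum>\<omega>\<in>UNIV. p' $ \<omega> * h \<omega>) \<le> (\<Sum>\<omega>\<in>UNIV. p $ \<omega> * h \<omega>)"
    using continuous_attains_sup[OF _ assms] by blast
  then have "(SUP p \<in> ?P. \<Sum>\<omega>\<in>UNIV. p $ \<omega> * h \<omega>) = (\<Sum>\<omega>\<in>UNIV. p $ \<omega> * h \<omega>)"
    by (intro cSup_eq_maximum) auto
  with p show ?thesis by blast
qed

lemma G_min_attained:
  assumes ne: "recourse_set D B b x \<omega> \<noteq> {}" and bd: "bounded (recourse_set D B b x \<omega>)"
    and pl: "0 \<le> pl $ \<omega>" and pu: "pl $ \<omega> \<le> pu $ \<omega>"
  shows "\<exists>(y, \<mu>, \<gamma>)\<in>G_feasible q L D B b \<xi> g \<omega> x l.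
           G q L D B b pl pu \<xi> g \<omega> x l = \<gamma> * pu $ \<omega> - \<mu> * pl $ \<omega> \<and>
           (\<forall>(y', \<mu>', \<gamma>')\<in>G_feasible q L D B b \<xi> g \<omega> x l.
              \<gamma> * pu $ \<omega> - \<mu> * pl $ \<omega> \<le> \<gamma>' * pu $ \<omega> - \<mu>' * pl $ \<omega>)"
    (is "\<exists>(y, \<mu>, \<gamma>)\<in>?F. _")
proof -
  obtain y where y: "y \<in> recourse_set D B b x \<omega>"
    "\<And>z. z \<in> recourse_set D B b x \<omega> \<Longrightarrow> psi0 q L x y \<omega> \<le> psi0 q L x z \<omega>"
    using recourse_min_attained[OF ne bd, of q L] by blast
  define t where "t = psi0 q L x y \<omega> - l \<bullet> g (\<xi> \<omega>)"
  define \<gamma> where "\<gamma> = max t 0"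
  define \<mu> where "\<mu> = max (- t) 0"
  have mem: "(y, \<mu>, \<gamma>) \<in> ?F"
    using y(1) by (auto simp: G_feasible_def \<gamma>_def \<mu>_def t_def)
  have min: "\<gamma> * pu $ \<omega> - \<mu> * pl $ \<omega> \<le> \<gamma>' * pu $ \<omega> - \<mu>' * pl $ \<omega>"
    if "(y', \<mu>', \<gamma>') \<in> ?F" for y' \<mu>' \<gamma>'
  proof -
    have *: "t \<le> \<gamma>' - \<mu>'" "0 \<le> \<gamma>'" "0 \<le> \<mu>'"
      using that y(2)[of y'] by (auto simp: G_feasible_def t_def)
    show ?thesis
    proof (cases "t \<ge> 0")
      case True
      have "t * pu $ \<omega> \<le> (\<gamma>' - \<mu>') * pu $ \<omega>"
        using *(1) pl pu by (intro mult_right_mono) auto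
      also have "\<dots> \<le> \<gamma>' * pu $ \<omega> - \<mu>' * pl $ \<omega>"
        using mult_left_mono[OF pu *(3)] by (simp add: algebra_simps)
      finally show ?thesis
        using True by (simp add: \<gamma>_def \<mu>_def)
    next
      case False
      have "t * pl $ \<omega> \<le> (\<gamma>' - \<mu>') * pl $ \<omega>"
        using *(1) pl by (intro mult_right_mono) auto
      also have "\<dots> \<le> \<gamma>' * pu $ \<omega> - \<mu>' * pl $ \<omega>"
        using mult_left_mono[OF pu *(2)] by (simp add: algebra_simps)
      finally show ?thesis
        using False by (simp add: \<gamma>_def \<mu>_def)
    qed
  qed
  have "G q L D B b pl pu \<xi> g \<omega> x l = \<gamma> * pu $ \<omega> - \<mu> * pl $ \<omega>"
    unfolding G_def using mem min by (intro cInf_eq_minimum) (auto intro!: rev_image_eqI[OF mem])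
  with mem min show ?thesis by blast
qed

end

theory Submission
  imports Defs
begin

text \<open>
  Fix \<open>x\<close>. The worst-case expectation is the value of a linear program in \<open>p\<close>, with objective
  vector \<open>h = recourse x\<close>, the box constraints \<open>pl \<le> p \<le> pu\<close> and the moment constraints
  \<open>\<Sum>\<omega>. p\<^sub>\<omega> g(\<xi>\<^sub>\<omega>) \<le> \<theta> x\<close>. Let \<open>l\<close>, \<open>\<gamma>\<close>, \<open>\<mu>\<close> be the nonnegative multipliers of the moment
  constraints, the upper bounds and the lower bounds. The dual program is to minimize
  \<open>l \<bullet> \<theta> x + (\<Sum>\<omega>. \<gamma>\<^sub>\<omega> pu\<^sub>\<omega> - \<mu>\<^sub>\<omega> pl\<^sub>\<omega>)\<close> subject to \<open>\<gamma>\<^sub>\<omega> - \<mu>\<^sub>\<omega> = h\<^sub>\<omega> - l \<bullet> g(\<xi>\<^sub>\<omega>)\<close>. For fixed \<open>l\<close>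
  it splits into one problem per scenario. In scenario \<open>\<omega>\<close> the equation may be relaxed to \<open>\<ge>\<close>,
  because \<open>0 \<le> pl \<le> pu\<close> makes the least cost of a pair nondecreasing in \<open>\<gamma> - \<mu>\<close>; and then
  \<open>h\<^sub>\<omega>\<close>, being the least value of \<open>psi0\<close>, may be replaced by \<open>psi0 x y \<omega>\<close> with \<open>y\<close> left to the
  minimization. The result is the problem that defines \<open>G\<close>.

  Weak duality bounds the distributionally robust objective at \<open>x\<close> by the two-stage objective at
  every \<open>(x, l)\<close> with \<open>l \<ge> 0\<close>. For the converse, the worst case is attained at some \<open>p\<close>. By
  Farkas' lemma the objective vector of a linear program is, at an optimal point, a nonnegative
  combination of the gradients of the active constraints. Its coefficients are dual variables with
  the same value, so the bound is attained at some \<open>l \<ge> 0\<close>. Thus the robust objective is the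
  attained minimum over \<open>l\<close> of the two-stage objective (\<open>dro_le_two_stage\<close> and
  \<open>two_stage_attains_dro\<close>), and the relation between optimal values and between minimizers is the
  general one for partial minimization.
\<close>

section \<open>Multipliers for linear programs\<close>

text \<open>
  Farkas' lemma. A finitely generated cone is closed, so a point outside it is strictly separated
  from it; as the cone is invariant under scaling, the separating functional has a constant sign on
  the generators.
\<close>

lemma farkas:
  fixes S :: "'a::euclidean_space set"
  assumes "finite S" and polar: "\<And>d. (\<And>a. a \<in> S \<Longrightarrow> a \<bullet> d \<le> 0) \<Longrightarrow> h \<bullet> d \<le> 0"
  shows "h \<in> convex_cone hull S"
proof (rule ccontr)
  let ?K = "convex_cone hull S"
  assume "h \<notin> ?K"
  then obtain v r where v: "v \<bullet> h < r" "\<And>x. x \<in> ?K \<Longrightarrow> r < v \<bullet> x"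
    using separating_hyperplane_closed_point[OF convex_convex_cone_hull
        closed_convex_cone_hull[OF \<open>finite S\<close>]] by blast
  have "r < 0"
    using v(2)[OF convex_cone_hull_contains_0] by simp
  have "0 \<le> v \<bullet> a" if "a \<in> S" for a
  proof (rule ccontr)
    assume "\<not> 0 \<le> v \<bullet> a"
    then have neg: "v \<bullet> a < 0" by simp
    \<comment> \<open>The multiple of \<open>a\<close> that lies exactly on the separating hyperplane.\<close>
    have "(r / (v \<bullet> a)) *\<^sub>R a \<in> ?K"
      using neg \<open>r < 0\<close> that
      by (intro convex_cone_hull_mul hull_inc) (auto intro: divide_nonpos_neg)
    from v(2)[OF this] neg show False by simp
  qed
  then have "h \<bullet> (- v) \<le> 0"
    by (intro polar) (simp add: inner_commute)
  with v(1) \<open>r < 0\<close> show False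
    by (simp add: inner_commute)
qed

text \<open>
  The Karush-Kuhn-Tucker conditions of a linear program. A direction along which no active
  constraint increases stays feasible for a short while, so the objective cannot increase along it,
  and \<open>farkas\<close> applies to the gradients of the active constraints.
\<close>

lemma lp_multipliers:
  fixes a :: "'j::finite \<Rightarrow> 'a::euclidean_space"
  assumes feas: "\<And>j. a j \<bullet> p \<le> \<beta> j"
    and opt: "\<And>p'. (\<And>j. a j \<bullet> p' \<le> \<beta> j) \<Longrightarrow> h \<bullet> p' \<le> h \<bullet> p"
  obtains m where "\<And>j. 0 \<le> m j" and "\<And>j. m j * (a j \<bullet> p) = m j * \<beta> j"
    and "h = (\<Sum>j\<in>UNIV. m j *\<^sub>R a j)"
proof -
  define J where "J = {j. a j \<bullet> p = \<beta> j}"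
  have "h \<in> convex_cone hull (a ` J)"
  proof (rule farkas)
    fix d
    assume d: "\<And>v. v \<in> a ` J \<Longrightarrow> v \<bullet> d \<le> 0"
    have "\<forall>\<^sub>F \<epsilon> in at_right 0. \<forall>j. a j \<bullet> (p + \<epsilon> *\<^sub>R d) \<le> \<beta> j"
    proof (rule eventually_all_finite)
      fix j
      show "\<forall>\<^sub>F \<epsilon> in at_right 0. a j \<bullet> (p + \<epsilon> *\<^sub>R d) \<le> \<beta> j"
      proof (cases "j \<in> J")
        case True
        with d[of "a j"] have "a j \<bullet> d \<le> 0" "a j \<bullet> p = \<beta> j"
          by (auto simp: J_def)
        then have "a j \<bullet> (p + \<epsilon> *\<^sub>R d) \<le> \<beta> j" if "0 < \<epsilon>" for \<epsilon>
          using that by (simp add: inner_add_right mult_nonneg_nonpos)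
        then show ?thesis
          by (intro eventually_mono[OF eventually_at_right_less]) simp
      next
        case False
        have "((\<lambda>\<epsilon>. a j \<bullet> (p + \<epsilon> *\<^sub>R d)) \<longlongrightarrow> a j \<bullet> (p + 0 *\<^sub>R d)) (at_right 0)"
          by (intro tendsto_intros)
        moreover have "a j \<bullet> (p + 0 *\<^sub>R d) < \<beta> j"
          using False feas[of j] by (auto simp: J_def)
        ultimately have "\<forall>\<^sub>F \<epsilon> in at_right 0. a j \<bullet> (p + \<epsilon> *\<^sub>R d) < \<beta> j"
          by (rule order_tendstoD(2))
        then show ?thesis
          by (rule eventually_mono) simp
      qed
    qed
    then have "\<forall>\<^sub>F \<epsilon> in at_right 0. 0 < \<epsilon> \<and> (\<forall>j. a j \<bullet> (p + \<epsilon> *\<^sub>R d) \<le> \<beta> j)"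
      by (intro eventually_conj eventually_at_right_less)
    then obtain \<epsilon> :: real where "0 < \<epsilon>" "\<forall>j. a j \<bullet> (p + \<epsilon> *\<^sub>R d) \<le> \<beta> j"
      using eventually_happens' trivial_limit_at_right_real by blast
    with opt[of "p + \<epsilon> *\<^sub>R d"] show "h \<bullet> d \<le> 0"
      by (simp add: inner_add_right mult_le_0_iff)
  qed simp
  also have "convex_cone hull (a ` J) \<subseteq>
      {v. \<exists>m. (\<forall>j. 0 \<le> m j) \<and> (\<forall>j. j \<notin> J \<longrightarrow> m j = 0) \<and> v = (\<Sum>j\<in>UNIV. m j *\<^sub>R a j)}"
    (is "_ \<subseteq> {v. \<exists>m. ?rep m v}")
  proof (rule hull_minimal)
    have "?rep (\<lambda>i. if i = j then 1 else 0) (a j)" if "j \<in> J" for j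
      using that by (auto simp: if_distrib[of "\<lambda>r. r *\<^sub>R _"] cong: if_cong)
    then show "a ` J \<subseteq> {v. \<exists>m. ?rep m v}"
      by (intro image_subsetI CollectI exI)
    show "convex_cone {v. \<exists>m. ?rep m v}"
      unfolding convex_cone_iff
    proof (intro conjI ballI allI impI)
      show "0 \<in> {v. \<exists>m. ?rep m v}"
        by (intro CollectI exI[of _ "\<lambda>_. 0"]) simp
    next
      fix u v
      assume "u \<in> {v. \<exists>m. ?rep m v}" "v \<in> {v. \<exists>m. ?rep m v}"
      then obtain m m' where "?rep m u" "?rep m' v"
        by (elim CollectE exE)
      then show "u + v \<in> {v. \<exists>m. ?rep m v}"
        by (intro CollectI exI[of _ "\<lambda>j. m j + m' j"]) (simp add: scaleR_add_left sum.distrib)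
    next
      fix v and k :: real
      assume "v \<in> {v. \<exists>m. ?rep m v}" "0 \<le> k"
      then obtain m where "?rep m v"
        by (elim CollectE exE)
      with \<open>0 \<le> k\<close> show "k *\<^sub>R v \<in> {v. \<exists>m. ?rep m v}"
        by (intro CollectI exI[of _ "\<lambda>j. k * m j"]) (simp add: scaleR_sum_right)
    qed
  qed
  finally obtain m where "?rep m h"
    by (elim CollectE exE)
  then show thesis
    by (intro that[of m]) (auto simp: J_def)
qed

section \<open>The dual of the worst-case problem\<close>

text \<open>
  Here the constraints are indexed by the sum of three types: moment constraints, upper bounds and
  lower bounds. Complementary slackness turns the dual value into the primal one.
\<close>

lemma worst_case_dual_multipliers:
  fixes pl pu :: "real^'w::finite" and g :: "real^'k \<Rightarrow> real^'s::finite" and h :: "'w \<Rightarrow> real"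
  assumes pl: "\<And>\<omega>. 0 \<le> pl $ \<omega>"
    and p: "p \<in> ambiguity_set pl pu \<xi> g \<theta> x"
    and opt: "\<And>p'. p' \<in> ambiguity_set pl pu \<xi> g \<theta> x \<Longrightarrow>
      (\<Sum>\<omega>\<in>UNIV. p' $ \<omega> * h \<omega>) \<le> (\<Sum>\<omega>\<in>UNIV. p $ \<omega> * h \<omega>)"
  obtains l \<gamma> \<mu> where "0 \<le> l" and "\<And>\<omega>. 0 \<le> \<gamma> \<omega>" and "\<And>\<omega>. 0 \<le> \<mu> \<omega>"
    and "\<And>\<omega>. \<gamma> \<omega> - \<mu> \<omega> = h \<omega> - l \<bullet> g (\<xi> \<omega>)"
    and "l \<bullet> \<theta> x + (\<Sum>\<omega>\<in>UNIV. \<gamma> \<omega> * pu $ \<omega> - \<mu> \<omega> * pl $ \<omega>) = (\<Sum>\<omega>\<in>UNIV. p $ \<omega> * h \<omega>)"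
proof -
  define a :: "'s + 'w + 'w \<Rightarrow> real^'w" where
    "a = case_sum (\<lambda>i. \<chi> \<omega>. g (\<xi> \<omega>) $ i) (case_sum (\<lambda>\<omega>. axis \<omega> 1) (\<lambda>\<omega>. - axis \<omega> 1))"
  define \<beta> :: "'s + 'w + 'w \<Rightarrow> real" where
    "\<beta> = case_sum (\<lambda>i. \<theta> x $ i) (case_sum (\<lambda>\<omega>. pu $ \<omega>) (\<lambda>\<omega>. - pl $ \<omega>))"
  have inner_a: "a (Inl i) \<bullet> v = (\<Sum>\<omega>\<in>UNIV. v $ \<omega> * g (\<xi> \<omega>) $ i)"
    "a (Inr (Inl \<omega>)) \<bullet> v = v $ \<omega>" "a (Inr (Inr \<omega>)) \<bullet> v = - v $ \<omega>" for i \<omega> v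
    by (simp_all add: a_def inner_axis') (simp add: inner_vec_def mult.commute)
  have member: "v \<in> ambiguity_set pl pu \<xi> g \<theta> x \<longleftrightarrow> (\<forall>j. a j \<bullet> v \<le> \<beta> j)" for v
    by (auto simp: split_sum_all inner_a \<beta>_def ambiguity_set_def less_eq_vec_def
        intro: order_trans[OF pl])
  have value_h: "(\<chi> \<omega>. h \<omega>) \<bullet> v = (\<Sum>\<omega>\<in>UNIV. v $ \<omega> * h \<omega>)" for v
    by (simp add: inner_vec_def mult.commute)
  obtain m where m: "\<And>j. 0 \<le> m j" "\<And>j. m j * (a j \<bullet> p) = m j * \<beta> j"
    and h: "(\<chi> \<omega>. h \<omega>) = (\<Sum>j\<in>UNIV. m j *\<^sub>R a j)"
    by (rule lp_multipliers[of a p \<beta> "\<chi> \<omega>. h \<omega>"]) (use p opt in \<open>auto simp: member value_h\<close>)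
  define l :: "real^'s" where "l = (\<chi> i. m (Inl i))"
  define \<gamma> where "\<gamma> \<omega> = m (Inr (Inl \<omega>))" for \<omega>
  define \<mu> where "\<mu> \<omega> = m (Inr (Inr \<omega>))" for \<omega>
  have sum_split: "(\<Sum>j\<in>UNIV. u j) = (\<Sum>i\<in>UNIV. u (Inl i)) +
      ((\<Sum>\<omega>\<in>UNIV. u (Inr (Inl \<omega>))) + (\<Sum>\<omega>\<in>UNIV. u (Inr (Inr \<omega>))))"
    for u :: "'s + 'w + 'w \<Rightarrow> real"
    using sum.Plus[of UNIV UNIV u] sum.Plus[of UNIV UNIV "u \<circ> Inr"] by simp
  show thesis
  proof
    show "0 \<le> l" "\<And>\<omega>. 0 \<le> \<gamma> \<omega>" "\<And>\<omega>. 0 \<le> \<mu> \<omega>"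
      using m(1) by (simp_all add: l_def \<gamma>_def \<mu>_def less_eq_vec_def)
    show "\<gamma> \<omega> - \<mu> \<omega> = h \<omega> - l \<bullet> g (\<xi> \<omega>)" for \<omega>
    proof -
      have "h \<omega> = (\<Sum>j\<in>UNIV. m j * a j $ \<omega>)"
        using arg_cong[OF h, of "\<lambda>v. v $ \<omega>"] by simp
      also have "\<dots> = l \<bullet> g (\<xi> \<omega>) + (\<gamma> \<omega> - \<mu> \<omega>)"
        by (simp add: sum_split a_def l_def \<gamma>_def \<mu>_def inner_vec_def axis_def sum_negf
            if_distrib[of "(*) _"] cong: if_cong)
      finally show ?thesis
        by simp
    qed
    have "(\<Sum>\<omega>\<in>UNIV. p $ \<omega> * h \<omega>) = (\<Sum>j\<in>UNIV. m j * (a j \<bullet> p))"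
      by (simp add: h inner_sum_left flip: value_h)
    also have "\<dots> = (\<Sum>j\<in>UNIV. m j * \<beta> j)"
      by (simp add: m(2))
    also have "\<dots> = l \<bullet> \<theta> x + (\<Sum>\<omega>\<in>UNIV. \<gamma> \<omega> * pu $ \<omega> - \<mu> \<omega> * pl $ \<omega>)"
      by (simp add: sum_split \<beta>_def l_def \<gamma>_def \<mu>_def inner_vec_def sum_negf sum_subtractf)
    finally show "l \<bullet> \<theta> x + (\<Sum>\<omega>\<in>UNIV. \<gamma> \<omega> * pu $ \<omega> - \<mu> \<omega> * pl $ \<omega>) = (\<Sum>\<omega>\<in>UNIV. p $ \<omega> * h \<omega>)"
      by simp
  qed
qed

section \<open>The scenario subproblems\<close>

text \<open>
  Weak duality within one scenario: weight the coupling constraint of \<open>G\<close> by \<open>p\<close>, and use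
  \<open>pl \<le> p \<le> pu\<close> on its two nonnegative terms.
\<close>

lemma G_ge:
  assumes "recourse_set D B b x \<omega> \<noteq> {}" "bounded (recourse_set D B b x \<omega>)"
    and "0 \<le> pl $ \<omega>" "pl $ \<omega> \<le> p" "p \<le> pu $ \<omega>"
  shows "p * (recourse q L D B b x \<omega> - l \<bullet> g (\<xi> \<omega>)) \<le> G q L D B b pl pu \<xi> g \<omega> x l"
proof -
  obtain y \<mu> \<gamma> where feas: "(y, \<mu>, \<gamma>) \<in> G_feasible q L D B b \<xi> g \<omega> x l"
    and G: "G q L D B b pl pu \<xi> g \<omega> x l = \<gamma> * pu $ \<omega> - \<mu> * pl $ \<omega>"
    using G_min_attained[of D B b x \<omega> pl pu q L \<xi> g l] assms by fastforce
  have "recourse q L D B b x \<omega> \<le> psi0 q L x y \<omega>"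
    using recourse_min_attained[OF assms(1,2), of q L] feas by (auto simp: G_feasible_def)
  then have "p * (recourse q L D B b x \<omega> - l \<bullet> g (\<xi> \<omega>)) \<le> p * (\<gamma> - \<mu>)"
    using feas assms by (intro mult_left_mono) (auto simp: G_feasible_def)
  also have "\<dots> \<le> \<gamma> * pu $ \<omega> - \<mu> * pl $ \<omega>"
    using feas assms mult_left_mono[of p "pu $ \<omega>" \<gamma>] mult_left_mono[of "pl $ \<omega>" p \<mu>]
    by (auto simp: G_feasible_def algebra_simps)
  finally show ?thesis
    by (simp add: G)
qed

text \<open>An optimal recourse decision completes any dual pair to a feasible point of \<open>G\<close>.\<close>

lemma G_le:
  assumes "recourse_set D B b x \<omega> \<noteq> {}" "bounded (recourse_set D B b x \<omega>)"
    and "0 \<le> pl $ \<omega>" "pl $ \<omega> \<le> pu $ \<omega>"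
    and "0 \<le> \<gamma>" "0 \<le> \<mu>" "recourse q L D B b x \<omega> - l \<bullet> g (\<xi> \<omega>) \<le> \<gamma> - \<mu>"
  shows "G q L D B b pl pu \<xi> g \<omega> x l \<le> \<gamma> * pu $ \<omega> - \<mu> * pl $ \<omega>"
proof -
  obtain y where "y \<in> recourse_set D B b x \<omega>" "recourse q L D B b x \<omega> = psi0 q L x y \<omega>"
    using recourse_min_attained[OF assms(1,2)] by blast
  then have "(y, \<mu>, \<gamma>) \<in> G_feasible q L D B b \<xi> g \<omega> x l"
    using assms by (simp add: G_feasible_def)
  then show ?thesis
    using G_min_attained[OF assms(1-4), of q L \<xi> g l] by fastforce
qed

section \<open>The two objectives\<close>

text \<open>
  Weak duality. Take a worst-case \<open>p\<close>, weight its moment constraints by \<open>l\<close>, and add the scenario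
  bounds.
\<close>

lemma dro_le_two_stage:
  assumes pl: "\<And>\<omega>. 0 \<le> pl $ \<omega>"
    and ne: "ambiguity_set pl pu \<xi> g \<theta> x \<noteq> {}"
    and rec: "\<And>\<omega>. recourse_set D B b x \<omega> \<noteq> {}" "\<And>\<omega>. bounded (recourse_set D B b x \<omega>)"
    and l: "0 \<le> l"
  shows "dro_objective c C q L D B b pl pu \<xi> g \<theta> x
    \<le> two_stage_objective c C q L D B b pl pu \<xi> g \<theta> x l"
proof -
  let ?h = "recourse q L D B b x"
  obtain p where p: "p \<in> ambiguity_set pl pu \<xi> g \<theta> x"
    and sup: "(SUP p \<in> ambiguity_set pl pu \<xi> g \<theta> x. \<Sum>\<omega>\<in>UNIV. p $ \<omega> * ?h \<omega>)
      = (\<Sum>\<omega>\<in>UNIV. p $ \<omega> * ?h \<omega>)"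
    using worst_case_attained[OF ne] by blast
  have "(\<Sum>\<omega>\<in>UNIV. p $ \<omega> * (l \<bullet> g (\<xi> \<omega>))) = (\<Sum>\<omega>\<in>UNIV. \<Sum>i\<in>UNIV. l $ i * (p $ \<omega> * g (\<xi> \<omega>) $ i))"
    by (simp add: inner_vec_def sum_distrib_left mult.left_commute)
  also have "\<dots> = (\<Sum>i\<in>UNIV. l $ i * (\<Sum>\<omega>\<in>UNIV. p $ \<omega> * g (\<xi> \<omega>) $ i))"
    by (subst sum.swap) (simp add: sum_distrib_left)
  also have "\<dots> \<le> (\<Sum>i\<in>UNIV. l $ i * \<theta> x $ i)"
    using p l by (intro sum_mono mult_left_mono) (auto simp: ambiguity_set_def less_eq_vec_def)
  finally have moments: "(\<Sum>\<omega>\<in>UNIV. p $ \<omega> * (l \<bullet> g (\<xi> \<omega>))) \<le> l \<bullet> \<theta> x"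
    by (simp add: inner_vec_def)
  have "(\<Sum>\<omega>\<in>UNIV. p $ \<omega> * (?h \<omega> - l \<bullet> g (\<xi> \<omega>))) \<le> (\<Sum>\<omega>\<in>UNIV. G q L D B b pl pu \<xi> g \<omega> x l)"
    using p pl rec by (intro sum_mono G_ge) (auto simp: ambiguity_set_def)
  with moments show ?thesis
    unfolding dro_objective_def two_stage_objective_def sup
    by (simp add: right_diff_distrib sum_subtractf)
qed

text \<open>
  Strong duality. The multipliers \<open>\<gamma>\<close> and \<open>\<mu>\<close> of the bounds on a worst-case \<open>p\<close> are feasible in the
  scenario subproblems at \<open>l\<close>, so the two-stage objective there is at most the dual value.
\<close>

lemma two_stage_attains_dro:
  assumes pl: "\<And>\<omega>. 0 \<le> pl $ \<omega>" and pu: "\<And>\<omega>. pl $ \<omega> \<le> pu $ \<omega>"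
    and ne: "ambiguity_set pl pu \<xi> g \<theta> x \<noteq> {}"
    and rec: "\<And>\<omega>. recourse_set D B b x \<omega> \<noteq> {}" "\<And>\<omega>. bounded (recourse_set D B b x \<omega>)"
  shows "\<exists>l\<ge>0. two_stage_objective c C q L D B b pl pu \<xi> g \<theta> x l
    = dro_objective c C q L D B b pl pu \<xi> g \<theta> x"
proof -
  let ?h = "recourse q L D B b x"
  obtain p where p: "p \<in> ambiguity_set pl pu \<xi> g \<theta> x"
    and sup: "(SUP p \<in> ambiguity_set pl pu \<xi> g \<theta> x. \<Sum>\<omega>\<in>UNIV. p $ \<omega> * ?h \<omega>)
      = (\<Sum>\<omega>\<in>UNIV. p $ \<omega> * ?h \<omega>)"
    and opt: "\<And>p'. p' \<in> ambiguity_set pl pu \<xi> g \<theta> x \<Longrightarrow>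
      (\<Sum>\<omega>\<in>UNIV. p' $ \<omega> * ?h \<omega>) \<le> (\<Sum>\<omega>\<in>UNIV. p $ \<omega> * ?h \<omega>)"
    using worst_case_attained[OF ne, of ?h] by blast
  obtain l \<gamma> \<mu> where l: "0 \<le> l" and nonneg: "\<And>\<omega>. 0 \<le> \<gamma> \<omega>" "\<And>\<omega>. 0 \<le> \<mu> \<omega>"
    and dual: "\<And>\<omega>. \<gamma> \<omega> - \<mu> \<omega> = ?h \<omega> - l \<bullet> g (\<xi> \<omega>)"
    and val: "l \<bullet> \<theta> x + (\<Sum>\<omega>\<in>UNIV. \<gamma> \<omega> * pu $ \<omega> - \<mu> \<omega> * pl $ \<omega>) = (\<Sum>\<omega>\<in>UNIV. p $ \<omega> * ?h \<omega>)"
    using worst_case_dual_multipliers[OF pl p opt] by blast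
  have "(\<Sum>\<omega>\<in>UNIV. G q L D B b pl pu \<xi> g \<omega> x l) \<le> (\<Sum>\<omega>\<in>UNIV. \<gamma> \<omega> * pu $ \<omega> - \<mu> \<omega> * pl $ \<omega>)"
    using pl pu rec nonneg dual by (intro sum_mono G_le) auto
  with val have "two_stage_objective c C q L D B b pl pu \<xi> g \<theta> x l
      \<le> dro_objective c C q L D B b pl pu \<xi> g \<theta> x"
    unfolding dro_objective_def two_stage_objective_def sup by simp
  with dro_le_two_stage[OF pl ne rec l] l show ?thesis
    by (blast intro: antisym)
qed

section \<open>Partial minimization\<close>

lemma INF_partial_minimum:
  fixes F :: "'a \<Rightarrow> 'b \<Rightarrow> 'c::complete_lattice"
  assumes "\<And>x y. x \<in> X \<Longrightarrow> y \<in> Y \<Longrightarrow> f x \<le> F x y"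
    and "\<And>x. x \<in> X \<Longrightarrow> \<exists>y\<in>Y. F x y = f x"
  shows "(INF x \<in> X. f x) = (INF (x, y) \<in> X \<times> Y. F x y)"
proof (rule antisym)
  show "(INF x \<in> X. f x) \<le> (INF (x, y) \<in> X \<times> Y. F x y)"
    using assms(1) by (auto intro!: INF_greatest intro: INF_lower2)
  show "(INF (x, y) \<in> X \<times> Y. F x y) \<le> (INF x \<in> X. f x)"
  proof (rule INF_greatest)
    fix x
    assume "x \<in> X"
    with assms(2) obtain y where "y \<in> Y" "F x y = f x"
      by blast
    with \<open>x \<in> X\<close> show "(INF (x, y) \<in> X \<times> Y. F x y) \<le> f x"
      by (intro INF_lower2[of "(x, y)"]) auto
  qed
qed

lemma is_arg_min_partial_minimum:
  fixes F :: "'a \<Rightarrow> 'b \<Rightarrow> 'c::linorder"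
  assumes lower: "\<And>x y. x \<in> X \<Longrightarrow> y \<in> Y \<Longrightarrow> f x \<le> F x y"
    and attained: "\<And>x. x \<in> X \<Longrightarrow> \<exists>y\<in>Y. F x y = f x"
  shows "is_arg_min f (\<lambda>x. x \<in> X) x \<longleftrightarrow>
    (\<exists>y\<in>Y. is_arg_min (\<lambda>(x, y). F x y) (\<lambda>(x, y). x \<in> X \<and> y \<in> Y) (x, y))"
proof
  assume "is_arg_min f (\<lambda>x. x \<in> X) x"
  then have x: "x \<in> X" "\<And>x'. x' \<in> X \<Longrightarrow> f x \<le> f x'"
    by (auto simp: is_arg_min_linorder)
  then obtain y where "y \<in> Y" "F x y = f x"
    using attained by blast
  with x show "\<exists>y\<in>Y. is_arg_min (\<lambda>(x, y). F x y) (\<lambda>(x, y). x \<in> X \<and> y \<in> Y) (x, y)"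
    by (auto simp: is_arg_min_linorder intro!: bexI[of _ y] intro: order_trans[OF _ lower])
next
  assume "\<exists>y\<in>Y. is_arg_min (\<lambda>(x, y). F x y) (\<lambda>(x, y). x \<in> X \<and> y \<in> Y) (x, y)"
  then obtain y where y: "x \<in> X" "y \<in> Y" "\<And>x' y'. x' \<in> X \<Longrightarrow> y' \<in> Y \<Longrightarrow> F x y \<le> F x' y'"
    by (auto simp: is_arg_min_linorder)
  have "f x \<le> f x'" if x': "x' \<in> X" for x'
  proof -
    obtain y' where "y' \<in> Y" "F x' y' = f x'"
      using attained[OF x'] by blast
    with y(3)[OF x' this(1)] lower[OF y(1,2)] show ?thesis
      by simp
  qed
  with y(1) show "is_arg_min f (\<lambda>x. x \<in> X) x"
    by (simp add: is_arg_min_linorder)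
qed

section \<open>The reformulation\<close>

theorem corollary1:
  fixes I :: "'n::finite set" and A :: "real^'n^'r::finite" and d :: "real^'r"
    and c :: "real^'n" and C :: "real^'n^'n"
    and q :: "'w::finite \<Rightarrow> real^'m::finite" and L :: "'w \<Rightarrow> real^'m^'n"
    and D :: "'w \<Rightarrow> real^'m^'l::finite" and B :: "'w \<Rightarrow> real^'n^'l" and b :: "'w \<Rightarrow> real^'l"
    and pl pu :: "real^'w" and \<xi> :: "'w \<Rightarrow> real^'k::finite"
    and g :: "real^'k \<Rightarrow> real^'s::finite" and \<theta> :: "real^'n \<Rightarrow> real^'s"
    and i1 i2 :: 's
  defines "X \<equiv> first_stage I A d"
    and "f \<equiv> dro_objective c C q L D B b pl pu \<xi> g \<theta>"
    and "F \<equiv> two_stage_objective c C q L D B b pl pu \<xi> g \<theta>"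
  assumes "X \<noteq> {}" and "compact X"
    and "\<And>\<omega>. 0 \<le> pl $ \<omega>" and "\<And>\<omega>. pl $ \<omega> \<le> pu $ \<omega>"
    and "\<And>\<omega>. g (\<xi> \<omega>) $ i1 = 1" and "\<And>x. x \<in> X \<Longrightarrow> \<theta> x $ i1 = 1"
    and "\<And>\<omega>. g (\<xi> \<omega>) $ i2 = -1" and "\<And>x. x \<in> X \<Longrightarrow> \<theta> x $ i2 = -1"
    and "\<And>x. x \<in> X \<Longrightarrow> ambiguity_set pl pu \<xi> g \<theta> x \<noteq> {}"
    and "\<And>x \<omega>. recourse_set D B b x \<omega> \<noteq> {}"
    and "\<And>x \<omega>. bounded (recourse_set D B b x \<omega>)"
  shows "(INF x \<in> X. ereal (f x)) = (INF (x, l) \<in> X \<times> {l. l \<ge> 0}. ereal (F x l)) \<and>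
    (\<forall>x\<in>X. is_arg_min f (\<lambda>x'. x' \<in> X) x \<longleftrightarrow>
       (\<exists>l\<ge>0. is_arg_min (\<lambda>(x', l'). F x' l') (\<lambda>(x', l'). x' \<in> X \<and> l' \<ge> 0) (x, l)))"
proof -
  have lower: "f x \<le> F x l" if "x \<in> X" "l \<in> {l. 0 \<le> l}" for x l
    using that assms(4-) unfolding f_def F_def by (intro dro_le_two_stage) auto
  have attained: "\<exists>l\<in>{l. 0 \<le> l}. F x l = f x" if "x \<in> X" for x
    using two_stage_attains_dro[of pl pu \<xi> g \<theta> x D B b c C q L] that assms(4-)
    unfolding f_def F_def by auto
  have "(INF x \<in> X. ereal (f x)) = (INF (x, l) \<in> X \<times> {l. 0 \<le> l}. ereal (F x l))"
    using lower attained by (intro INF_partial_minimum) auto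
  with is_arg_min_partial_minimum[of X "{l. 0 \<le> l}" f F, OF lower attained] show ?thesis
    by simp
qed

end
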